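(* Let $A$ and $B$ be $n\times n$ positive definite matrices and let $0\le t\le 1$. For real $p\neq 0$ let $F_t(p)=\left((1-t)A^p+tB^p\right)^{1/p}$, and let $F_t(0)=\lim_{p\to 0}F_t(p)=e^{(1-t)\log A+t\log B}$. Then for every unitarily invariant norm $|||\cdot|||$ on the space of $n\times n$ matrices, $|||F_t(p)|||$ is an increasing function of $p$ on $(-\infty,\infty)$.
   Context: Matrices are $n\times n$ (complex), and positive definite matrices are Hermitian. Real powers and logarithms of positive definite matrices are defined by the usual functional calculus. A norm $|||\cdot|||$ on $n\times n$ matrices is unitarily invariant if $|||UXV|||=|||X|||$ for all matrices $X$ and all unitary $U,V$. "Increasing" means nondecreasing. It is a known fact (Bhagwat and Subramanian) that $\lim_{p\to0}\left((1-t)A^p+tB^p\right)^{1/p}=e^{(1-t)\log A+t\log B}$. *)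

theory Defs
  imports "HOL-Analysis.Analysis"
begin

definition conj_transpose :: "complex^'n^'m \<Rightarrow> complex^'m^'n" where
  "conj_transpose A = map_matrix cnj (transpose A)"

definition hermitian_matrix :: "complex^'n^'n \<Rightarrow> bool" where
  "hermitian_matrix A \<longleftrightarrow> conj_transpose A = A"

definition unitary_matrix :: "complex^'n^'n \<Rightarrow> bool" where
  "unitary_matrix U \<longleftrightarrow> conj_transpose U ** U = mat 1 \<and> U ** conj_transpose U = mat 1"

(* For Hermitian A the quadratic form x* A x is real, so taking Re loses nothing. *)
definition positive_definite :: "complex^'n^'n \<Rightarrow> bool" where
  "positive_definite A \<longleftrightarrow> hermitian_matrix A \<and>
     (\<forall>x. x \<noteq> 0 \<longrightarrow> 0 < Re (\<Sum>i\<in>UNIV. cnj (x $ i) * (A *v x) $ i))"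

definition diag_matrix :: "('n \<Rightarrow> real) \<Rightarrow> complex^'n^'n" where
  "diag_matrix d = (\<chi> i j. if i = j then complex_of_real (d i) else 0)"

(* f(A) = U diag(f(d)) U* for any unitary diagonalisation A = U diag(d) U*; independence of
   the diagonalisation is the lemma functional_calculus_diag.  Only meaningful for Hermitian A. *)
definition functional_calculus :: "(real \<Rightarrow> real) \<Rightarrow> complex^'n^'n \<Rightarrow> complex^'n^'n" where
  "functional_calculus f A =
     (THE X. \<exists>U d. unitary_matrix U \<and> A = U ** diag_matrix d ** conj_transpose U \<and>
        X = U ** diag_matrix (f \<circ> d) ** conj_transpose U)"

lemma diag_intertwine:
  assumes "W ** diag_matrix d = diag_matrix e ** W"
  shows "W ** diag_matrix (f \<circ> d) = diag_matrix (f \<circ> e) ** W"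
proof -
  have r: "(W ** diag_matrix g) $ i $ j = W $ i $ j * complex_of_real (g j)" for g i j
    by (simp add: matrix_matrix_mult_def diag_matrix_def if_distrib[where f = "\<lambda>x. _ * x"]
        cong: if_cong)
  have l: "(diag_matrix g ** W) $ i $ j = complex_of_real (g i) * W $ i $ j" for g i j
    by (simp add: matrix_matrix_mult_def diag_matrix_def if_distrib[where f = "\<lambda>x. x * _"]
        cong: if_cong)
  have "W $ i $ j = 0 \<or> d j = e i" for i j
  proof -
    have "W $ i $ j * complex_of_real (d j) = complex_of_real (e i) * W $ i $ j"
      using arg_cong[OF assms, of "\<lambda>M. M $ i $ j"] by (simp add: r l)
    then show ?thesis by simp
  qed
  then have "(W ** diag_matrix (f \<circ> d)) $ i $ j = (diag_matrix (f \<circ> e) ** W) $ i $ j" for i j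
    by (metis (no_types, lifting) comp_apply l mult.commute mult_zero_right r)
  then show ?thesis by (simp add: vec_eq_iff)
qed

lemma functional_calculus_diag:
  assumes U: "unitary_matrix U"
  shows "functional_calculus f (U ** diag_matrix d ** conj_transpose U)
         = U ** diag_matrix (f \<circ> d) ** conj_transpose U"
  unfolding functional_calculus_def
proof (rule the_equality)
  show "\<exists>V e. unitary_matrix V \<and>
      U ** diag_matrix d ** conj_transpose U = V ** diag_matrix e ** conj_transpose V \<and>
      U ** diag_matrix (f \<circ> d) ** conj_transpose U = V ** diag_matrix (f \<circ> e) ** conj_transpose V"
    using U by blast
next
  fix X
  assume "\<exists>V e. unitary_matrix V \<and>
      U ** diag_matrix d ** conj_transpose U = V ** diag_matrix e ** conj_transpose V \<and>
      X = V ** diag_matrix (f \<circ> e) ** conj_transpose V"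
  then obtain V e where V: "unitary_matrix V"
    and eq: "U ** diag_matrix d ** conj_transpose U = V ** diag_matrix e ** conj_transpose V"
    and X: "X = V ** diag_matrix (f \<circ> e) ** conj_transpose V" by blast
  note u = U[unfolded unitary_matrix_def] and v = V[unfolded unitary_matrix_def]
  let ?W = "conj_transpose V ** U"
  have "?W ** diag_matrix d = conj_transpose V ** (U ** diag_matrix d ** conj_transpose U) ** U"
    using u by (metis matrix_mul_assoc matrix_mul_rid)
  also have "\<dots> = diag_matrix e ** ?W"
    unfolding eq using v by (metis matrix_mul_assoc matrix_mul_lid)
  finally have "?W ** diag_matrix (f \<circ> d) = diag_matrix (f \<circ> e) ** ?W"
    by (rule diag_intertwine)
  then have "V ** (?W ** diag_matrix (f \<circ> d)) ** conj_transpose U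
      = V ** (diag_matrix (f \<circ> e) ** ?W) ** conj_transpose U" by simp
  moreover have "V ** (?W ** diag_matrix (f \<circ> d)) ** conj_transpose U
      = U ** diag_matrix (f \<circ> d) ** conj_transpose U"
    using v by (metis matrix_mul_assoc matrix_mul_lid)
  moreover have "V ** (diag_matrix (f \<circ> e) ** ?W) ** conj_transpose U = X"
    unfolding X using u by (metis matrix_mul_assoc matrix_mul_rid)
  ultimately show "X = U ** diag_matrix (f \<circ> d) ** conj_transpose U" by simp
qed

definition matrix_powr :: "complex^'n^'n \<Rightarrow> real \<Rightarrow> complex^'n^'n" where
  "matrix_powr A r = functional_calculus (\<lambda>x. x powr r) A"

definition matrix_log :: "complex^'n^'n \<Rightarrow> complex^'n^'n" where
  "matrix_log A = functional_calculus ln A"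

definition matrix_exp :: "complex^'n^'n \<Rightarrow> complex^'n^'n" where
  "matrix_exp A = functional_calculus exp A"

definition power_mean :: "complex^'n^'n \<Rightarrow> complex^'n^'n \<Rightarrow> real \<Rightarrow> real \<Rightarrow> complex^'n^'n" where
  "power_mean A B t p =
     (if p = 0 then matrix_exp ((1 - t) *\<^sub>R matrix_log A + t *\<^sub>R matrix_log B)
      else matrix_powr ((1 - t) *\<^sub>R matrix_powr A p + t *\<^sub>R matrix_powr B p) (1 / p))"

definition matrix_norm :: "(complex^'n^'n \<Rightarrow> real) \<Rightarrow> bool" where
  "matrix_norm N \<longleftrightarrow>
     (\<forall>X. 0 \<le> N X) \<and> (\<forall>X. N X = 0 \<longleftrightarrow> X = 0) \<and>
     (\<forall>c X. N (map_matrix (\<lambda>z. c * z) X) = cmod c * N X) \<and>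
     (\<forall>X Y. N (X + Y) \<le> N X + N Y)"

definition unitarily_invariant_norm :: "(complex^'n^'n \<Rightarrow> real) \<Rightarrow> bool" where
  "unitarily_invariant_norm N \<longleftrightarrow> matrix_norm N \<and>
     (\<forall>U V X. unitary_matrix U \<longrightarrow> unitary_matrix V \<longrightarrow> N (U ** X ** V) = N X)"

end

(* Every eigenvalue of F_t(p), in decreasing order, is a nondecreasing function of p. For 0 < p < q put
   r = p/q, X = A^q, Y = B^q: operator concavity of x^r gives
   (1-t)X^r + tY^r <= ((1-t)X + tY)^r in the Loewner order, Weyl's monotonicity principle turns this into
   an inequality between eigenvalues, and these survive the power 1/p. For p < q < 0 put
   r = q/p, X = A^p, Y = B^p; the power 1/q then reverses the inequality. The two half-lines are joined
   through the limit at 0, and a unitarily invariant norm is monotone in the eigenvalues of a positive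
   matrix because diag(a) is a convex combination of sign changes of diag(b) when 0 <= a <= b. *)

theory Submission
  imports Defs
begin

section \<open>Spectral theorem\<close>

text \<open>For 0 < p < 1 the outer exponent 1/p exceeds 1, and such powers are in general not
  operator monotone, so the Loewner inequality between the inner averages cannot be carried over to
  F_t(p) itself. Increasing scalar functions do preserve eigenvalue inequalities, and eigenvalues
  are all that a unitarily invariant norm of a positive matrix sees; hence the descent to
  eigenvalues before the outer power is taken. Operator concavity of x^r is reached without an
  integral representation of x^r: a positive block matrix with diagonal blocks M^a and M^b bounds
  its Hermitian off-diagonal block by M^((a+b)/2), which makes the admissible exponents closed under
  midpoints. At 0 only the scalar function |||F_t(p)||| has to pass to the limit, so monotonicity
  there asks for nothing but convergence of the matrices and continuity of the norm.\<close>

lemma conj_transpose_nth [simp]: "conj_transpose A $ i $ j = cnj (A $ j $ i)"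
  by (simp add: conj_transpose_def map_matrix_def transpose_def)

lemma conj_transpose_conj_transpose [simp]: "conj_transpose (conj_transpose A) = A"
  by (simp add: vec_eq_iff)

lemma conj_transpose_mult: "conj_transpose (A ** B) = conj_transpose B ** conj_transpose A"
  by (simp add: vec_eq_iff matrix_matrix_mult_def mult.commute)

lemma conj_transpose_add: "conj_transpose (A + B) = conj_transpose A + conj_transpose B"
  by (simp add: vec_eq_iff)

lemma conj_transpose_scaleR: "conj_transpose (c *\<^sub>R A) = c *\<^sub>R conj_transpose A"
  by (simp add: vec_eq_iff)

lemma conj_transpose_mat_1 [simp]: "conj_transpose (mat 1) = mat 1"
  by (simp add: vec_eq_iff mat_def)

lemma conj_transpose_diag [simp]: "conj_transpose (diag_matrix d) = diag_matrix d"
  by (simp add: vec_eq_iff diag_matrix_def)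

lemma inner_complex_vec: "x \<bullet> y = Re (\<Sum>i\<in>UNIV. cnj (x $ i) * y $ i)" for x y :: "complex^'n"
  by (simp add: inner_vec_def inner_complex_def)

lemma inner_matrix_vector: "(A *v x) \<bullet> y = x \<bullet> (conj_transpose A *v y)"
  for A :: "complex^'n^'m"
proof -
  have "(\<Sum>i\<in>UNIV. cnj ((A *v x) $ i) * y $ i) = (\<Sum>i\<in>UNIV. \<Sum>j\<in>UNIV. cnj (A $ i $ j) * cnj (x $ j) * y $ i)"
    by (simp add: matrix_vector_mult_def sum_distrib_right)
  also have "\<dots> = (\<Sum>j\<in>UNIV. \<Sum>i\<in>UNIV. cnj (A $ i $ j) * cnj (x $ j) * y $ i)"
    by (rule sum.swap)
  also have "\<dots> = (\<Sum>j\<in>UNIV. cnj (x $ j) * (conj_transpose A *v y) $ j)"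
    by (simp add: matrix_vector_mult_def sum_distrib_left mult_ac)
  finally show ?thesis by (simp add: inner_complex_vec)
qed

lemma hermitian_inner: "hermitian_matrix A \<Longrightarrow> (A *v x) \<bullet> y = x \<bullet> (A *v y)"
  by (simp add: inner_matrix_vector hermitian_matrix_def)

lemma scaleR_matrix_vector: "(c *\<^sub>R A) *v x = c *\<^sub>R (A *v x)" for A :: "complex^'n^'m"
  by (simp add: vec_eq_iff matrix_vector_mult_def scaleR_sum_right)

lemma matrix_vector_scaleR: "A *v (c *\<^sub>R x) = c *\<^sub>R (A *v x)" for A :: "complex^'n^'m"
  by (simp add: vec_eq_iff matrix_vector_mult_def scaleR_sum_right)

lemma unitary_conj_transpose: "unitary_matrix U \<Longrightarrow> unitary_matrix (conj_transpose U)"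
  by (simp add: unitary_matrix_def)

lemma unitary_norm: "unitary_matrix U \<Longrightarrow> norm (U *v x) = norm x"
  by (simp add: norm_eq_sqrt_inner inner_matrix_vector unitary_matrix_def matrix_vector_mul_assoc)

lemma diag_mult_vec: "(diag_matrix d *v x) $ i = complex_of_real (d i) * x $ i"
  by (simp add: matrix_vector_mult_def diag_matrix_def if_distrib[where f = "\<lambda>x. x * _"] cong: if_cong)

lemma diag_mult_diag: "diag_matrix d ** diag_matrix e = diag_matrix (\<lambda>i. d i * e i)"
  by (simp add: vec_eq_iff matrix_matrix_mult_def diag_matrix_def
      if_distrib[where f = "\<lambda>x. x * _"] cong: if_cong)

text \<open>Keeps a unitary diagonalisation and its real eigenvalue list explicit, so that the
  functional calculus becomes an operation on \<open>d\<close> alone.\<close>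

definition spectral_form :: "complex^'n^'n \<Rightarrow> ('n \<Rightarrow> real) \<Rightarrow> complex^'n^'n" where
  "spectral_form U d = U ** diag_matrix d ** conj_transpose U"

lemma spectral_form_inner:
  "x \<bullet> (spectral_form U d *v x) = (\<Sum>i\<in>UNIV. d i * (cmod ((conj_transpose U *v x) $ i))\<^sup>2)"
proof -
  let ?y = "conj_transpose U *v x"
  have "x \<bullet> (spectral_form U d *v x) = ?y \<bullet> (diag_matrix d *v ?y)"
    by (simp add: spectral_form_def inner_matrix_vector flip: matrix_vector_mul_assoc)
  also have "\<dots> = (\<Sum>i\<in>UNIV. d i * (cmod (?y $ i))\<^sup>2)"
    by (simp add: inner_vec_def diag_mult_vec cmod_power2)
       (auto intro!: sum.cong simp: inner_complex_def power2_eq_square algebra_simps)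
  finally show ?thesis .
qed

lemma norm_sq_complex_vec: "x \<bullet> x = (\<Sum>i\<in>UNIV. (cmod (x $ i))\<^sup>2)" for x :: "complex^'n"
  by (simp add: inner_vec_def power2_norm_eq_inner)

lemma hermitian_spectral_form: "hermitian_matrix (spectral_form U d)"
  by (simp add: hermitian_matrix_def spectral_form_def conj_transpose_mult matrix_mul_assoc)

lemma spectral_form_mult:
  assumes "unitary_matrix U"
  shows "spectral_form U d ** spectral_form U e = spectral_form U (\<lambda>i. d i * e i)"
proof -
  have "spectral_form U d ** spectral_form U e
      = U ** diag_matrix d ** (conj_transpose U ** U) ** diag_matrix e ** conj_transpose U"
    by (simp add: spectral_form_def matrix_mul_assoc)
  then show ?thesis
    using assms by (simp add: unitary_matrix_def spectral_form_def diag_mult_diag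
        flip: matrix_mul_assoc) (simp add: matrix_mul_assoc diag_mult_diag)
qed

lemma functional_calculus_spectral_form:
  "unitary_matrix U \<Longrightarrow> functional_calculus f (spectral_form U d) = spectral_form U (\<lambda>i. f (d i))"
  using functional_calculus_diag[of U f d] by (simp add: spectral_form_def comp_def)

lemma spectral_form_nth:
  "spectral_form U d $ i $ j = (\<Sum>k\<in>UNIV. U $ i $ k * complex_of_real (d k) * cnj (U $ j $ k))"
  by (simp add: spectral_form_def matrix_matrix_mult_def diag_matrix_def
      if_distrib[where f = "\<lambda>x. _ * x"] cong: if_cong)

lemma spectral_form_one:
  fixes U :: "complex^'n^'n"
  assumes "unitary_matrix U"
  shows "spectral_form U (\<lambda>i. 1) = mat 1"
proof -
  have "diag_matrix (\<lambda>i. 1) = (mat 1 :: complex^'n^'n)"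
    by (simp add: vec_eq_iff diag_matrix_def mat_def)
  with assms show ?thesis by (simp add: spectral_form_def unitary_matrix_def)
qed

lemma spectral_form_affine:
  assumes "unitary_matrix U"
  shows "spectral_form U (\<lambda>i. c * (d i - 1)) = c *\<^sub>R (spectral_form U d - mat 1)"
proof -
  have "spectral_form U (\<lambda>i. c * (d i - 1)) = c *\<^sub>R (spectral_form U d - spectral_form U (\<lambda>i. 1))"
    by (simp add: vec_eq_iff spectral_form_nth algebra_simps scaleR_sum_right sum_subtractf scaleR_conv_of_real[where 'a=complex] sum_distrib_left)
  then show ?thesis using assms by (simp add: spectral_form_one)
qed

text \<open>Fewer than n conditions, written as the rows of a square matrix, leave a zero row; the
  determinant vanishes and the kernel is nontrivial. Orthogonality is a complex sum because
  \<bullet> on complex vectors is only the real part of the Hermitian product.\<close>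

lemma exists_orthogonal_vector:
  fixes f :: "'k \<Rightarrow> complex^'n"
  assumes "finite K" "card K < CARD('n)"
  shows "\<exists>x. x \<noteq> 0 \<and> (\<forall>k\<in>K. (\<Sum>i\<in>UNIV. cnj (f k $ i) * x $ i) = 0)"
proof -
  obtain J :: "'n set" where J: "card J = card K"
    using assms(2) by (metis obtain_subset_with_card_n less_imp_le)
  then obtain h where h: "bij_betw h J K"
    using assms(1) by (metis finite bij_betw_iff_card)
  have "J \<noteq> UNIV" using J assms(2) by auto
  then obtain j0 where j0: "j0 \<notin> J" by auto
  define M :: "complex^'n^'n" where "M = (\<chi> j i. if j \<in> J then cnj (f (h j) $ i) else 0)"
  have "row j0 M = 0" using j0 by (simp add: M_def row_def vec_eq_iff)
  then have "det M = 0" by (rule det_zero_row)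
  then have "\<not> invertible M" by (simp add: invertible_det_nz)
  then obtain x where x: "x \<noteq> 0" "M *v x = 0"
    unfolding invertible_left_inverse matrix_left_invertible_ker by blast
  have "(\<Sum>i\<in>UNIV. cnj (f k $ i) * x $ i) = 0" if "k \<in> K" for k
  proof -
    have "k \<in> h ` J" using h that by (simp add: bij_betw_def)
    then obtain j where j: "j \<in> J" "h j = k" by blast
    have "(M *v x) $ j = 0" using x by simp
    then show ?thesis using j by (simp add: M_def matrix_vector_mult_def)
  qed
  with x show ?thesis by (intro exI[of _ x] conjI ballI)
qed

text \<open>Rayleigh's principle: \<open>A\<close> leaves the orthogonal complement of the
  eigenvectors already found invariant, and a maximiser of the quadratic form on the unit sphere of
  this complement is an eigenvector.\<close>

lemma hermitian_orthogonal_eigenvector: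
  fixes A :: "complex^'n^'n" and v :: "'k \<Rightarrow> complex^'n"
  assumes A: "hermitian_matrix A" and I: "finite I" "card I < CARD('n)"
    and ev: "\<And>i. i \<in> I \<Longrightarrow> A *v v i = d i *\<^sub>R v i"
  shows "\<exists>x l. norm x = 1 \<and> A *v x = l *\<^sub>R x \<and> (\<forall>i\<in>I. (\<Sum>k\<in>UNIV. cnj (v i $ k) * x $ k) = 0)"
proof -
  define P where "P x \<longleftrightarrow> (\<forall>i\<in>I. (\<Sum>k\<in>UNIV. cnj (v i $ k) * x $ k) = 0)" for x :: "complex^'n"
  have P_scale: "P (c *\<^sub>R x)" if "P x" for c x
    using that by (simp add: P_def flip: scaleR_sum_right)
  have P_add: "P (x + y)" if "P x" "P y" for x y
    using that by (simp add: P_def ring_distribs sum.distrib)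
  have P_A: "P (A *v x)" if "P x" for x
    unfolding P_def
  proof
    fix i assume i: "i \<in> I"
    have "(\<Sum>k\<in>UNIV. cnj (v i $ k) * (A *v x) $ k) = (\<Sum>k\<in>UNIV. cnj ((conj_transpose A *v v i) $ k) * x $ k)"
      by (simp add: matrix_vector_mult_def sum_distrib_left sum_distrib_right mult_ac)
         (rule sum.swap)
    also have "conj_transpose A *v v i = d i *\<^sub>R v i"
      using A ev[OF i] by (simp add: hermitian_matrix_def)
    finally show "(\<Sum>k\<in>UNIV. cnj (v i $ k) * (A *v x) $ k) = 0"
      using that i by (simp add: P_def flip: scaleR_sum_right)
  qed
  obtain x0 where x0: "x0 \<noteq> 0" "P x0"
    using exists_orthogonal_vector[OF I, of v] by (auto simp: P_def)
  define S where "S = {x. norm x = 1} \<inter> {x. P x}"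
  have "closed {x. P x}"
    unfolding P_def Ball_def by (intro closed_Collect_all closed_Collect_imp open_Collect_const closed_Collect_eq continuous_intros)
  moreover have "compact {x :: complex^'n. norm x = 1}"
    using compact_sphere[of "0 :: complex^'n" 1] by (simp add: sphere_def dist_norm)
  ultimately have "compact S" by (simp add: S_def compact_Int_closed)
  moreover have "(1 / norm x0) *\<^sub>R x0 \<in> S" using x0 P_scale by (auto simp: S_def)
  moreover have "continuous_on S (\<lambda>x. x \<bullet> (A *v x))"
    by (intro continuous_intros matrix_vector_mult_linear_continuous_on)
  ultimately obtain x where x: "x \<in> S" and mx: "\<And>y. y \<in> S \<Longrightarrow> y \<bullet> (A *v y) \<le> x \<bullet> (A *v x)"
    using continuous_attains_sup[of S "\<lambda>x. x \<bullet> (A *v x)"] by blast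
  define l where "l = x \<bullet> (A *v x)"
  have xx: "x \<bullet> x = 1" "P x" using x by (auto simp: S_def norm_eq_1)
  have q: "y \<bullet> (A *v y) \<le> l * (y \<bullet> y)" if "P y" for y
  proof (cases "y = 0")
    case False
    have "(1 / norm y) *\<^sub>R y \<in> S" using False that P_scale by (auto simp: S_def)
    from mx[OF this] show ?thesis using False
      by (simp add: l_def matrix_vector_scaleR field_simps flip: power2_norm_eq_inner)
         (simp add: power2_eq_square mult_ac)
  qed simp
  \<comment> \<open>The residual of the eigenvalue equation. It again satisfies \<open>P\<close>, so
    \<open>x\<close> may be perturbed in its direction.\<close>
  define y where "y = A *v x - l *\<^sub>R x"
  have Py: "P y" unfolding y_def using P_add[OF P_A P_scale[of x "-l"]] xx by simp
  define C where "C = l * (y \<bullet> y) - y \<bullet> (A *v y)"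
  \<comment> \<open>The first-order gain along \<open>y\<close> is 2e|y|^2; since \<open>x\<close>
    is a maximiser, the second-order term has to absorb it.\<close>
  have *: "2 * e * (y \<bullet> y) \<le> e\<^sup>2 * C" for e
  proof -
    have le: "(x + e *\<^sub>R y) \<bullet> (A *v (x + e *\<^sub>R y)) \<le> l * ((x + e *\<^sub>R y) \<bullet> (x + e *\<^sub>R y))"
      by (intro q P_add P_scale Py xx)
    have 1: "(x + e *\<^sub>R y) \<bullet> (A *v (x + e *\<^sub>R y))
       = l + 2 * e * (y \<bullet> (A *v x)) + e\<^sup>2 * (y \<bullet> (A *v y))"
      using hermitian_inner[OF A, of x y]
      by (simp add: matrix_vector_right_distrib matrix_vector_scaleR inner_add_left inner_add_right
          l_def power2_eq_square inner_commute algebra_simps)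
    have 2: "(x + e *\<^sub>R y) \<bullet> (x + e *\<^sub>R y) = 1 + 2 * e * (y \<bullet> x) + e\<^sup>2 * (y \<bullet> y)"
      using xx by (simp add: inner_add_left inner_add_right power2_eq_square inner_commute algebra_simps)
    have "y \<bullet> y = y \<bullet> (A *v x) - l * (y \<bullet> x)"
      by (subst (2) y_def) (simp add: inner_diff_right)
    then have "2 * e * (y \<bullet> y) = 2 * e * (y \<bullet> (A *v x)) - 2 * e * (l * (y \<bullet> x))"
      by (simp only: right_diff_distrib)
    with le[unfolded 1 2] show ?thesis by (simp add: C_def algebra_simps)
  qed
  have "y \<bullet> y \<le> 0"
  proof (rule ccontr)
    assume "\<not> y \<bullet> y \<le> 0"
    then have yy: "0 < y \<bullet> y" by (simp only: not_le)
    \<comment> \<open>Small enough that \<open>e * C\<close> is at most |y|^2, whereas the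
      inequality just proved requires 2|y|^2.\<close>
    define e where "e = (y \<bullet> y) / (\<bar>C\<bar> + 1)"
    have e: "e > 0" using yy by (simp add: e_def)
    have "2 * (y \<bullet> y) \<le> e * C" using *[of e] e by (simp add: power2_eq_square)
    also have "\<dots> \<le> e * (\<bar>C\<bar> + 1)" using e by (intro mult_left_mono) auto
    also have "\<dots> = y \<bullet> y" by (simp add: e_def)
    finally show False using yy by simp
  qed
  then have "y \<bullet> y = 0" using inner_ge_zero[of y] by linarith
  then have "y = 0" by (simp only: inner_eq_zero_iff)
  then have "A *v x = l *\<^sub>R x" by (simp add: y_def)
  moreover have "norm x = 1" using xx by (simp add: norm_eq_1)
  ultimately show ?thesis using xx(2) unfolding P_def by (intro exI[of _ x] exI[of _ l] conjI)
qed

theorem hermitian_diagonalizable: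
  fixes A :: "complex^'n^'n"
  assumes A: "hermitian_matrix A"
  obtains U d where "unitary_matrix U" "A = spectral_form U d"
proof -
  \<comment> \<open>The induction runs over sets of indices, since the dimension is a type and
    cannot be lowered. The complex orthonormality in \<open>Q\<close> becomes unitarity of the
    matrix with columns \<open>v j\<close>.\<close>
  define Q where "Q I v d \<longleftrightarrow> (\<forall>i\<in>I. A *v v i = d i *\<^sub>R v i) \<and>
      (\<forall>i\<in>I. \<forall>j\<in>I. (\<Sum>k\<in>UNIV. cnj (v i $ k) * v j $ k) = (if i = j then 1 else 0))"
    for I :: "'n set" and v d
  have "\<exists>v d. Q I v d"
    if "finite I" for I :: "'n set"
    using that
  proof (induction I rule: finite_induct)
    case empty
    then show ?case by (simp add: Q_def)
  next
    case (insert m I)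
    then obtain v d where "Q I v d" by blast
    then have v: "\<And>i. i \<in> I \<Longrightarrow> A *v v i = d i *\<^sub>R v i"
      and o: "\<And>i j. i \<in> I \<Longrightarrow> j \<in> I \<Longrightarrow> (\<Sum>k\<in>UNIV. cnj (v i $ k) * v j $ k) = (if i = j then 1 else 0)"
      by (simp_all add: Q_def)
    have "I \<subset> UNIV" using insert by auto
    then have "card I < CARD('n)" by (simp add: psubset_card_mono)
    from hermitian_orthogonal_eigenvector[where v = v and d = d, OF A insert(1) this v]
    obtain x l where x: "norm x = 1" "A *v x = l *\<^sub>R x"
      and xo: "\<And>i. i \<in> I \<Longrightarrow> (\<Sum>k\<in>UNIV. cnj (v i $ k) * x $ k) = 0" by blast
    have xo': "(\<Sum>k\<in>UNIV. cnj (x $ k) * v i $ k) = 0" if "i \<in> I" for i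
      using arg_cong[OF xo[OF that], of cnj] by (simp add: mult.commute)
    have xx: "(\<Sum>k\<in>UNIV. cnj (x $ k) * x $ k) = 1"
    proof -
      have "(\<Sum>k\<in>UNIV. cnj (x $ k) * x $ k) = of_real (x \<bullet> x)"
        by (simp add: norm_sq_complex_vec mult.commute[of "cnj _"] flip: complex_norm_square)
      then show ?thesis using x by (simp add: norm_eq_1)
    qed
    show ?case
      unfolding Q_def
      by (rule exI[of _ "v(m := x)"], rule exI[of _ "d(m := l)"])
         (use insert(2) v o x xo xo' xx in auto)
  qed
  from this[of UNIV, OF finite] obtain v d where "Q UNIV v d" by blast
  then have v: "\<And>i. A *v v i = d i *\<^sub>R v i"
    and o: "\<And>i j. (\<Sum>k\<in>UNIV. cnj (v i $ k) * v j $ k) = (if i = j then 1 else 0)"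
    by (simp_all add: Q_def)
  define U :: "complex^'n^'n" where "U = (\<chi> i j. v j $ i)"
  have U1: "conj_transpose U ** U = mat 1"
    by (simp add: vec_eq_iff matrix_matrix_mult_def U_def mat_def o)
  then have U: "unitary_matrix U"
    by (simp add: unitary_matrix_def matrix_left_right_inverse)
  have "A ** U = U ** diag_matrix d"
  proof -
    have "(A ** U) $ i $ j = (U ** diag_matrix d) $ i $ j" for i j
    proof -
      have "(A *v v j) $ i = complex_of_real (d j) * v j $ i"
        unfolding v vector_scaleR_component by (simp add: scaleR_conv_of_real)
      then show ?thesis
        by (simp add: matrix_matrix_mult_def matrix_vector_mult_def U_def diag_matrix_def
            if_distrib[where f = "\<lambda>x. _ * x"] mult.commute cong: if_cong)
    qed
    then show ?thesis by (simp add: vec_eq_iff)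
  qed
  then have "A = U ** diag_matrix d ** conj_transpose U"
    using U by (metis unitary_matrix_def matrix_mul_assoc matrix_mul_rid)
  then show ?thesis using that U by (simp add: spectral_form_def)
qed

section \<open>Operator concavity of powers\<close>

lemma positive_definite_inner:
  "positive_definite A \<longleftrightarrow> hermitian_matrix A \<and> (\<forall>x. x \<noteq> 0 \<longrightarrow> 0 < x \<bullet> (A *v x))"
  by (simp add: positive_definite_def inner_complex_vec)

lemma unitary_conj_transpose_eq_0:
  assumes "unitary_matrix U" shows "conj_transpose U *v x = 0 \<longleftrightarrow> x = 0"
  using unitary_norm[OF unitary_conj_transpose[OF assms], of x] by (metis norm_eq_zero)

lemma positive_definite_spectral_form:
  fixes U :: "complex^'n^'n"
  assumes U: "unitary_matrix U"
  shows "positive_definite (spectral_form U d) \<longleftrightarrow> (\<forall>i. 0 < d i)"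
proof
  assume pd: "positive_definite (spectral_form U d)"
  show "\<forall>i. 0 < d i"
  proof
    fix i
    let ?x = "U *v axis i 1"
    have e: "conj_transpose U *v ?x = axis i 1"
      using U by (simp add: matrix_vector_mul_assoc unitary_matrix_def)
    then have "?x \<noteq> 0"
      by (auto simp: axis_eq_0_iff)
    with pd have "0 < ?x \<bullet> (spectral_form U d *v ?x)" by (simp add: positive_definite_inner)
    also have "\<dots> = (\<Sum>j\<in>UNIV. if j = i then d j else 0)"
      unfolding spectral_form_inner e by (intro sum.cong) (auto simp: axis_def)
    finally show "0 < d i" by simp
  qed
next
  assume d: "\<forall>i. 0 < d i"
  show "positive_definite (spectral_form U d)"
    unfolding positive_definite_inner
  proof (intro conjI allI impI hermitian_spectral_form)
    fix x :: "complex^'n" assume "x \<noteq> 0"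
    then have "conj_transpose U *v x \<noteq> 0" using U by (simp add: unitary_conj_transpose_eq_0)
    then obtain i where "(conj_transpose U *v x) $ i \<noteq> 0" by (auto simp: vec_eq_iff)
    then show "0 < x \<bullet> (spectral_form U d *v x)"
      unfolding spectral_form_inner using d
      by (intro sum_pos2[of _ i]) (auto simp: less_imp_le)
  qed
qed

lemma positive_definite_diagonalizable:
  assumes "positive_definite A"
  obtains U d where "unitary_matrix U" "A = spectral_form U d" "\<And>i. 0 < d i"
  using assms hermitian_diagonalizable positive_definite_inner positive_definite_spectral_form
  by metis

section \<open>Exponent laws for powers of a positive definite matrix\<close>

lemma matrix_powr_spectral_form:
  "unitary_matrix U \<Longrightarrow> matrix_powr (spectral_form U d) r = spectral_form U (\<lambda>i. d i powr r)"
  by (simp add: matrix_powr_def functional_calculus_spectral_form)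

lemma positive_definite_powr:
  assumes "positive_definite A" shows "positive_definite (matrix_powr A r)"
proof (rule positive_definite_diagonalizable[OF assms])
  fix U d assume U: "unitary_matrix U" and A: "A = spectral_form U d" and d: "\<And>i. 0 < d i"
  have "0 < d i powr r" for i using d[of i] by simp
  then show ?thesis by (simp add: A U matrix_powr_spectral_form positive_definite_spectral_form)
qed

lemma hermitian_powr: "positive_definite A \<Longrightarrow> hermitian_matrix (matrix_powr A r)"
  using positive_definite_inner positive_definite_powr by blast

lemma matrix_powr_0:
  assumes "positive_definite A" shows "matrix_powr A 0 = mat 1"
proof (rule positive_definite_diagonalizable[OF assms])
  fix U d assume U: "unitary_matrix U" and A: "A = spectral_form U d" and d: "\<And>i. 0 < d i"
  have "d i \<noteq> 0" for i using d[of i] by simp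
  then show ?thesis by (simp add: A U matrix_powr_spectral_form spectral_form_one)
qed

lemma matrix_powr_1: "positive_definite A \<Longrightarrow> matrix_powr A 1 = A"
  by (erule positive_definite_diagonalizable)
     (simp add: matrix_powr_spectral_form less_imp_le)

lemma matrix_powr_add:
  "positive_definite A \<Longrightarrow> matrix_powr A r ** matrix_powr A s = matrix_powr A (r + s)"
  by (erule positive_definite_diagonalizable)
     (simp add: matrix_powr_spectral_form spectral_form_mult powr_add)

lemma matrix_powr_powr:
  "positive_definite A \<Longrightarrow> matrix_powr (matrix_powr A r) s = matrix_powr A (r * s)"
  by (erule positive_definite_diagonalizable)
     (simp add: matrix_powr_spectral_form powr_powr)

lemma matrix_powr_vec_add:
  "positive_definite A \<Longrightarrow> matrix_powr A r *v (matrix_powr A s *v x) = matrix_powr A (r + s) *v x"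
  by (simp add: matrix_vector_mul_assoc matrix_powr_add)

lemma matrix_powr_inner:
  assumes "positive_definite A"
  shows "(matrix_powr A r *v x) \<bullet> (matrix_powr A s *v y) = x \<bullet> (matrix_powr A (r + s) *v y)"
  using assms by (simp add: hermitian_inner[OF hermitian_powr] matrix_powr_vec_add)

section \<open>Weighted averages and the Loewner order\<close>

definition wavg :: "real \<Rightarrow> complex^'n^'n \<Rightarrow> complex^'n^'n \<Rightarrow> complex^'n^'n" where
  "wavg t A B = (1 - t) *\<^sub>R A + t *\<^sub>R B"

lemma wavg_mult_vec: "wavg t A B *v x = (1 - t) *\<^sub>R (A *v x) + t *\<^sub>R (B *v x)"
  by (simp add: wavg_def matrix_vector_mult_add_rdistrib scaleR_matrix_vector)

lemma hermitian_wavg: "hermitian_matrix A \<Longrightarrow> hermitian_matrix B \<Longrightarrow> hermitian_matrix (wavg t A B)"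
  by (simp add: hermitian_matrix_def wavg_def conj_transpose_add conj_transpose_scaleR)

lemma inner_wavg: "x \<bullet> (wavg t A B *v y) = (1 - t) * (x \<bullet> (A *v y)) + t * (x \<bullet> (B *v y))"
  by (simp add: wavg_mult_vec inner_add_right)

lemma positive_definite_wavg:
  assumes "positive_definite A" "positive_definite B" "0 \<le> t" "t \<le> 1"
  shows "positive_definite (wavg t A B)"
proof -
  have "0 < (1 - t) * a + t * b" if "0 < a" "0 < b" for a b :: real
    using assms(3,4) that
    by (cases "t = 0") (auto intro!: add_nonneg_pos)
  then show ?thesis
    using assms by (simp add: positive_definite_inner hermitian_wavg inner_wavg)
qed

text \<open>For Hermitian matrices the quadratic form is real, so comparing real inner products
  gives the usual Loewner order.\<close>

definition loewner_le :: "complex^'n^'n \<Rightarrow> complex^'n^'n \<Rightarrow> bool" where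
  "loewner_le A B \<longleftrightarrow> (\<forall>x. x \<bullet> (A *v x) \<le> x \<bullet> (B *v x))"

text \<open>The block matrix with diagonal \<open>M\<^sup>a\<close>, \<open>M\<^sup>b\<close> and off-diagonal entries \<open>C\<close> is positive, so \<open>C\<close> is at
  most the geometric mean of \<open>M\<^sup>a\<close> and \<open>M\<^sup>b\<close>. The test vectors come from an eigenvector \<open>h\<close> of
  \<open>H = M\<^bsup>-c/2\<^esup> C M\<^bsup>-c/2\<^esup>\<close>, chosen so that all three terms reduce to the same number \<open>k\<close>.\<close>

lemma loewner_le_mid_powr:
  fixes M C :: "complex^'n^'n"
  assumes M: "positive_definite M" and C: "hermitian_matrix C"
    and block: "\<And>u v. 0 \<le> u \<bullet> (matrix_powr M a *v u) + 2 * (u \<bullet> (C *v v)) + v \<bullet> (matrix_powr M b *v v)"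
  shows "loewner_le C (matrix_powr M ((a + b) / 2))"
proof -
  define c where "c = (a + b) / 2"
  define R where "R = matrix_powr M (- c / 2)"
  define H where "H = R ** C ** R"
  have R: "hermitian_matrix R" by (simp add: R_def hermitian_powr M)
  have "hermitian_matrix H"
    using R C by (simp add: H_def hermitian_matrix_def conj_transpose_mult matrix_mul_assoc)
  then obtain W m where W: "unitary_matrix W" and Hs: "H = spectral_form W m"
    by (rule hermitian_diagonalizable)
  \<comment> \<open>Congruence by \<open>R\<close> turns M^c into the identity, so the claim becomes
    that no eigenvalue of \<open>H\<close> exceeds 1.\<close>
  have m: "m i \<le> 1" for i
  proof -
    define h where "h = W *v axis i 1"
    have e: "conj_transpose W *v h = axis i 1"
      using W by (simp add: h_def matrix_vector_mul_assoc unitary_matrix_def)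
    then have "h \<noteq> 0"
      by (auto simp: axis_eq_0_iff)
    have "diag_matrix m *v axis i 1 = m i *\<^sub>R (axis i 1 :: complex^'n)"
      by (simp add: vec_eq_iff diag_mult_vec axis_def) (simp add: scaleR_conv_of_real)
    then have Hh: "H *v h = m i *\<^sub>R h"
      by (simp add: Hs spectral_form_def e matrix_vector_scaleR h_def flip: matrix_vector_mul_assoc)
         (use e h_def in \<open>simp add: matrix_vector_scaleR\<close>)
    define k where "k = h \<bullet> (matrix_powr M ((b - a) / 2) *v h)"
    \<comment> \<open>The exponent s = (b - 3a)/4 is determined by 2s + a = (b - a)/2. The other two
      exponents agree with it: s + c/2 and b - c are also (b - a)/2.\<close>
    define u where "u = matrix_powr M ((b - 3 * a) / 4) *v h"
    define v where "v = R *v h"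
    have "C *v v = matrix_powr M (c / 2) *v (R *v (C *v v))"
      unfolding R_def by (simp add: matrix_powr_vec_add M matrix_powr_0)
    also have "R *v (C *v v) = H *v h" by (simp add: H_def v_def matrix_vector_mul_assoc matrix_mul_assoc)
    finally have Cv: "C *v v = m i *\<^sub>R (matrix_powr M (c / 2) *v h)"
      by (simp add: Hh matrix_vector_scaleR)
    have "u \<bullet> (C *v v) = m i * k"
      unfolding Cv u_def k_def inner_scaleR_right matrix_powr_inner[OF M]
      by (rule arg_cong[where f = "\<lambda>e. m i * (h \<bullet> (matrix_powr M e *v h))"]) (simp add: c_def field_simps)
    moreover have "u \<bullet> (matrix_powr M a *v u) = k"
      unfolding u_def k_def matrix_powr_vec_add[OF M] matrix_powr_inner[OF M]
      by (rule arg_cong[where f = "\<lambda>e. h \<bullet> (matrix_powr M e *v h)"]) (simp add: c_def field_simps)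
    moreover have "v \<bullet> (matrix_powr M b *v v) = k"
      unfolding v_def k_def R_def matrix_powr_vec_add[OF M] matrix_powr_inner[OF M]
      by (rule arg_cong[where f = "\<lambda>e. h \<bullet> (matrix_powr M e *v h)"]) (simp add: c_def field_simps)
    \<comment> \<open>Inserting \<open>-u\<close> gives the cross term a minus sign: the block form
      becomes k - 2 \<open>m i\<close> k + k.\<close>
    ultimately have "0 \<le> 2 * k * (1 - m i)"
      using block[of "-u" v] matrix_vector_scaleR[of "matrix_powr M a" "-1" u] by (simp add: algebra_simps)
    moreover have "0 < k"
      using \<open>h \<noteq> 0\<close> positive_definite_powr[OF M] by (simp add: k_def positive_definite_inner)
    ultimately show ?thesis by (simp add: zero_le_mult_iff)
  qed
  have Hle: "y \<bullet> (H *v y) \<le> y \<bullet> y" for y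
  proof -
    have "y \<bullet> (H *v y) \<le> (\<Sum>i\<in>UNIV. 1 * (cmod ((conj_transpose W *v y) $ i))\<^sup>2)"
      unfolding Hs spectral_form_inner by (intro sum_mono mult_right_mono m) auto
    also have "\<dots> = (conj_transpose W *v y) \<bullet> (conj_transpose W *v y)"
      by (simp add: norm_sq_complex_vec)
    also have "\<dots> = y \<bullet> y"
      using unitary_norm[OF unitary_conj_transpose[OF W]] by (simp flip: power2_norm_eq_inner)
    finally show ?thesis .
  qed
  show ?thesis
    unfolding loewner_le_def
  proof
    fix x
    let ?y = "matrix_powr M (c / 2) *v x"
    have Ry: "R *v ?y = x" by (simp add: R_def matrix_powr_vec_add M matrix_powr_0)
    have "x \<bullet> (C *v x) = (R *v ?y) \<bullet> (C *v (R *v ?y))" by (simp add: Ry)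
    also have "\<dots> = ?y \<bullet> (H *v ?y)"
      using R by (simp add: H_def hermitian_inner flip: matrix_vector_mul_assoc)
    also have "\<dots> \<le> ?y \<bullet> ?y" by (rule Hle)
    also have "\<dots> = x \<bullet> (matrix_powr M c *v x)" by (simp add: matrix_powr_inner[OF M])
    finally show "x \<bullet> (C *v x) \<le> x \<bullet> (matrix_powr M ((a + b) / 2) *v x)" by (simp add: c_def)
  qed
qed

text \<open>The form is the square |A^(a/2) u + A^(b/2) v|^2; the two cross terms coincide because
  the powers are Hermitian.\<close>

lemma powr_block_nonneg:
  assumes "positive_definite A"
  shows "0 \<le> u \<bullet> (matrix_powr A a *v u) + 2 * (u \<bullet> (matrix_powr A ((a + b) / 2) *v v))
    + v \<bullet> (matrix_powr A b *v v)"
proof -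
  let ?w = "matrix_powr A (a / 2) *v u + matrix_powr A (b / 2) *v v"
  have "u \<bullet> (matrix_powr A ((a + b) / 2) *v v) = v \<bullet> (matrix_powr A ((a + b) / 2) *v u)"
    using hermitian_inner[OF hermitian_powr[OF assms], of _ u v] by (simp add: inner_commute)
  then have "?w \<bullet> ?w = u \<bullet> (matrix_powr A a *v u) + 2 * (u \<bullet> (matrix_powr A ((a + b) / 2) *v v))
    + v \<bullet> (matrix_powr A b *v v)"
    by (simp add: inner_add_left inner_add_right matrix_powr_inner[OF assms] add_divide_distrib add.commute)
  then show ?thesis by (metis inner_ge_zero)
qed

text \<open>Averaging the block forms of \<open>A\<close> and \<open>B\<close> keeps them
  nonnegative. The hypotheses enlarge the diagonal blocks to M^a and M^b with M =
  \<open>wavg t A B\<close>, and the off-diagonal block, the average of the c-th powers, is then at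
  most M^c.\<close>

lemma wavg_powr_le_midpoint:
  fixes A B :: "complex^'n^'n"
  assumes A: "positive_definite A" and B: "positive_definite B" and t: "0 \<le> t" "t \<le> 1"
    and a: "loewner_le (wavg t (matrix_powr A a) (matrix_powr B a)) (matrix_powr (wavg t A B) a)"
    and b: "loewner_le (wavg t (matrix_powr A b) (matrix_powr B b)) (matrix_powr (wavg t A B) b)"
    and c: "c = (a + b) / 2"
  shows "loewner_le (wavg t (matrix_powr A c) (matrix_powr B c)) (matrix_powr (wavg t A B) c)"
  unfolding c
proof (rule loewner_le_mid_powr)
  show "positive_definite (wavg t A B)" by (rule positive_definite_wavg[OF A B t])
  show "hermitian_matrix (wavg t (matrix_powr A ((a + b) / 2)) (matrix_powr B ((a + b) / 2)))"
    by (intro hermitian_wavg hermitian_powr A B)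
  fix u v :: "complex^'n"
  let ?f = "\<lambda>A :: complex^'n^'n. u \<bullet> (matrix_powr A a *v u) + 2 * (u \<bullet> (matrix_powr A ((a + b) / 2) *v v))
    + v \<bullet> (matrix_powr A b *v v)"
  have "0 \<le> (1 - t) * ?f A + t * ?f B"
    using t by (intro add_nonneg_nonneg mult_nonneg_nonneg powr_block_nonneg A B) auto
  also have "\<dots> = u \<bullet> (wavg t (matrix_powr A a) (matrix_powr B a) *v u)
      + 2 * (u \<bullet> (wavg t (matrix_powr A ((a + b) / 2)) (matrix_powr B ((a + b) / 2)) *v v))
      + v \<bullet> (wavg t (matrix_powr A b) (matrix_powr B b) *v v)"
    unfolding inner_wavg by (simp add: algebra_simps)
  also have "\<dots> \<le> u \<bullet> (matrix_powr (wavg t A B) a *v u)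
      + 2 * (u \<bullet> (wavg t (matrix_powr A ((a + b) / 2)) (matrix_powr B ((a + b) / 2)) *v v))
      + v \<bullet> (matrix_powr (wavg t A B) b *v v)"
    using a b by (auto simp: loewner_le_def intro!: add_mono)
  finally show "0 \<le> u \<bullet> (matrix_powr (wavg t A B) a *v u)
      + 2 * (u \<bullet> (wavg t (matrix_powr A ((a + b) / 2)) (matrix_powr B ((a + b) / 2)) *v v))
      + v \<bullet> (matrix_powr (wavg t A B) b *v v)" .
qed

lemma continuous_inner_powr:
  assumes "positive_definite A"
  shows "continuous_on UNIV (\<lambda>r. x \<bullet> (matrix_powr A r *v x))"
proof (rule positive_definite_diagonalizable[OF assms])
  fix U d assume U: "unitary_matrix U" and A: "A = spectral_form U d" and d: "\<And>i. 0 < d i"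
  have "d i \<noteq> 0" for i using d[of i] by simp
  then show ?thesis
    unfolding A matrix_powr_spectral_form[OF U] spectral_form_inner by (intro continuous_intros) simp
qed

text \<open>Equality holds at the exponents 0 and 1; midpoints then give every dyadic rational of
  [0,1], and continuity in the exponent gives the rest.\<close>

theorem operator_concave_powr:
  fixes A B :: "complex^'n^'n"
  assumes A: "positive_definite A" and B: "positive_definite B" and t: "0 \<le> t" "t \<le> 1"
    and r: "0 \<le> r" "r \<le> 1"
  shows "loewner_le (wavg t (matrix_powr A r) (matrix_powr B r)) (matrix_powr (wavg t A B) r)"
proof -
  define G where "G r \<longleftrightarrow> loewner_le (wavg t (matrix_powr A r) (matrix_powr B r)) (matrix_powr (wavg t A B) r)" for r
  note M = positive_definite_wavg[OF A B t]
  have mid: "G ((a + b) / 2)" if "G a" "G b" for a b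
    using wavg_powr_le_midpoint[OF A B t _ _ refl] that by (simp add: G_def)
  have 0: "G 0"
    by (simp add: G_def matrix_powr_0 A B M loewner_le_def inner_wavg left_diff_distrib)
  have 1: "G 1"
    by (simp add: G_def matrix_powr_1 A B M loewner_le_def)
  have dyadic: "G (real k / 2 ^ n)" if "k \<le> 2 ^ n" for k n
    using that
  proof (induction n arbitrary: k)
    case 0
    then have "k = 0 \<or> k = 1" by auto
    then show ?case using \<open>G 0\<close> 1 by auto
  next
    case (Suc n)
    show ?case
    proof (cases "even k")
      case True
      then obtain l where "k = 2 * l" by blast
      then show ?thesis using Suc by simp
    next
      case False
      then obtain l where l: "k = 2 * l + 1" using oddE by blast
      \<comment> \<open>An odd numerator 2l + 1 at level n + 1 is the midpoint of l and l + 1 at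
        level n.\<close>
      have "G (real l / 2 ^ n)" by (rule Suc.IH) (use Suc.prems l in simp)
      moreover have "G (real (Suc l) / 2 ^ n)" by (rule Suc.IH) (use Suc.prems l in simp)
      ultimately have "G ((real l / 2 ^ n + real (Suc l) / 2 ^ n) / 2)" by (rule mid)
      then show ?thesis by (simp add: l mult.commute add.commute flip: add_divide_distrib)
    qed
  qed
  have "closed {r. G r}"
    unfolding G_def loewner_le_def inner_wavg
    by (intro closed_Collect_all closed_Collect_le continuous_on_add
        continuous_on_mult continuous_on_const continuous_inner_powr A B M)
  \<comment> \<open>Dyadic truncations of \<open>r\<close> stay below \<open>r\<close>, hence in
    [0,1], and lie within 2^-n of it.\<close>
  moreover have "(\<lambda>n. real (nat \<lfloor>r * 2 ^ n\<rfloor>) / 2 ^ n) \<longlonglongrightarrow> r"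
  proof (rule tendsto_sandwich)
    show "\<forall>\<^sub>F n in sequentially. r - (1/2) ^ n \<le> real (nat \<lfloor>r * 2 ^ n\<rfloor>) / 2 ^ n"
    proof (rule always_eventually, rule allI)
      fix n
      have "r * 2 ^ n - 1 \<le> real (nat \<lfloor>r * 2 ^ n\<rfloor>)" using r by linarith
      then have "(r * 2 ^ n - 1) / 2 ^ n \<le> real (nat \<lfloor>r * 2 ^ n\<rfloor>) / 2 ^ n"
        by (intro divide_right_mono) auto
      then show "r - (1/2) ^ n \<le> real (nat \<lfloor>r * 2 ^ n\<rfloor>) / 2 ^ n"
        by (simp add: diff_divide_distrib power_divide)
    qed
    show "\<forall>\<^sub>F n in sequentially. real (nat \<lfloor>r * 2 ^ n\<rfloor>) / 2 ^ n \<le> r"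
      using r by (intro always_eventually allI) (simp add: divide_le_eq of_nat_floor)
    show "(\<lambda>n. r - (1/2) ^ n) \<longlonglongrightarrow> r"
      using tendsto_diff[OF tendsto_const LIMSEQ_realpow_zero[of "1/2"], of r] by simp
  qed auto
  moreover have "G (real (nat \<lfloor>r * 2 ^ n\<rfloor>) / 2 ^ n)" for n
  proof (rule dyadic)
    have "real (nat \<lfloor>r * 2 ^ n\<rfloor>) \<le> r * 2 ^ n" using r by (simp add: of_nat_floor)
    also have "\<dots> \<le> real (2 ^ n)" using r by simp
    finally show "nat \<lfloor>r * 2 ^ n\<rfloor> \<le> 2 ^ n" by (simp only: of_nat_le_iff)
  qed
  ultimately have "G r"
    using closed_sequentially[of "{r. G r}" "\<lambda>n. real (nat \<lfloor>r * 2 ^ n\<rfloor>) / 2 ^ n" r] by simp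
  then show ?thesis by (simp add: G_def)
qed

section \<open>Eigenvalue inequalities and unitarily invariant norms\<close>

text \<open>Greedy matching: the largest \<open>d\<close> value is paired with any sufficient
  \<open>e\<close> value and both are removed. For thresholds up to that largest value each count
  drops by one; above it the left count is zero.\<close>

lemma inj_on_card_ge_matching:
  fixes d :: "'a \<Rightarrow> real" and e :: "'b \<Rightarrow> real"
  assumes "finite I" "finite J"
    and "\<And>c. card {i\<in>I. c \<le> d i} \<le> card {j\<in>J. c \<le> e j}"
  shows "\<exists>s. inj_on s I \<and> s ` I \<subseteq> J \<and> (\<forall>i\<in>I. d i \<le> e (s i))"
  using assms
proof (induction "card I" arbitrary: I J)
  case 0
  then show ?case by simp
next
  case (Suc n)
  then have "I \<noteq> {}" by auto
  then have "Max (d ` I) \<in> d ` I" using Suc.prems(1) by (intro Max_in) auto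
  then obtain i0 where i0': "i0 \<in> I" "Max (d ` I) = d i0" by blast
  then have i0: "i0 \<in> I" "\<And>i. i \<in> I \<Longrightarrow> d i \<le> d i0"
    using Suc.prems(1) by (auto simp flip: i0'(2))
  have "{i\<in>I. d i0 \<le> d i} \<noteq> {}" using i0 by auto
  then have "0 < card {i\<in>I. d i0 \<le> d i}" using Suc.prems(1) by (simp add: card_gt_0_iff)
  also have "\<dots> \<le> card {j\<in>J. d i0 \<le> e j}" by (rule Suc.prems)
  finally have "{j\<in>J. d i0 \<le> e j} \<noteq> {}" by (metis card.empty less_irrefl)
  then obtain j0 where j0: "j0 \<in> J" "d i0 \<le> e j0" by blast
  have "card {i\<in>I - {i0}. c \<le> d i} \<le> card {j\<in>J - {j0}. c \<le> e j}" for c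
  proof (cases "c \<le> d i0")
    case True
    have "{i\<in>I - {i0}. c \<le> d i} = {i\<in>I. c \<le> d i} - {i0}"
      "{j\<in>J - {j0}. c \<le> e j} = {j\<in>J. c \<le> e j} - {j0}" by auto
    then show ?thesis
      using Suc.prems(3)[of c] True i0 j0 by (simp add: card_Diff_singleton)
  next
    case False
    then have "{i\<in>I - {i0}. c \<le> d i} = {}" using i0(2) by fastforce
    then show ?thesis by (metis card.empty zero_le)
  qed
  moreover have "n = card (I - {i0})" using Suc.hyps(2) i0(1) by simp
  ultimately obtain s where s: "inj_on s (I - {i0})" "s ` (I - {i0}) \<subseteq> J - {j0}"
    "\<forall>i\<in>I - {i0}. d i \<le> e (s i)"
    using Suc.hyps(1)[of "I - {i0}" "J - {j0}"] Suc.prems by blast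
  have "inj_on (s(i0 := j0)) I"
    using s(1,2) by (auto simp: inj_on_def)
  moreover have "s(i0 := j0) ` I \<subseteq> J" using s(2) j0 by auto
  moreover have "\<forall>i\<in>I. d i \<le> e ((s(i0 := j0)) i)" using s(3) j0 by auto
  ultimately show ?case by blast
qed

text \<open>If the counts were the other way round, a dimension count would give a nonzero x spanned
  both by eigenvectors of the smaller matrix with \<open>d i\<close> \<ge> c and by eigenvectors of
  the larger one with \<open>e i\<close> < c. Its quadratic forms would then contradict the Loewner
  inequality.\<close>

lemma spectral_count_mono:
  fixes U W :: "complex^'n^'n"
  assumes U: "unitary_matrix U" and W: "unitary_matrix W"
    and le: "loewner_le (spectral_form U d) (spectral_form W e)"
  shows "card {i. c \<le> d i} \<le> card {i. c \<le> e i}"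
proof (rule ccontr)
  assume less: "\<not> card {i. c \<le> d i} \<le> card {i. c \<le> e i}"
  \<comment> \<open>A disjoint sum, because one index may contribute an eigenvector of each
    matrix.\<close>
  define K where "K = {i. d i < c} <+> {i. c \<le> e i}"
  define f where "f = case_sum (\<lambda>i. column i U) (\<lambda>i. column i W)"
  have "card {i. d i < c} + card {i. c \<le> d i} = CARD('n)"
    by (subst card_Un_disjoint[symmetric]) (auto intro!: arg_cong[where f = card])
  then have "card K < CARD('n)" using less by (simp add: K_def card_Plus)
  moreover have "finite K" by (simp add: K_def)
  ultimately obtain x where x: "x \<noteq> 0" and K0: "\<forall>k\<in>K. (\<Sum>i\<in>UNIV. cnj (f k $ i) * x $ i) = 0"
    using exists_orthogonal_vector[of K f] by blast
  have xU: "(conj_transpose U *v x) $ i = 0" if "d i < c" for i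
    using bspec[OF K0, of "Inl i"] that by (simp add: K_def f_def column_def matrix_vector_mult_def InlI InrI)
  have xW: "(conj_transpose W *v x) $ i = 0" if "c \<le> e i" for i
    using bspec[OF K0, of "Inr i"] that by (simp add: K_def f_def column_def matrix_vector_mult_def InlI InrI)
  have n: "(\<Sum>i\<in>UNIV. c * (cmod ((conj_transpose V *v x) $ i))\<^sup>2) = c * (x \<bullet> x)"
    if "unitary_matrix V" for V :: "complex^'n^'n"
  proof -
    have "(conj_transpose V *v x) \<bullet> (conj_transpose V *v x) = x \<bullet> x"
      using unitary_norm[OF unitary_conj_transpose[OF that], of x]
      by (simp flip: power2_norm_eq_inner)
    then show ?thesis by (simp add: norm_sq_complex_vec flip: sum_distrib_left)
  qed
  have "c * (x \<bullet> x) \<le> x \<bullet> (spectral_form U d *v x)"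
    unfolding n[OF U, symmetric] spectral_form_inner
  proof (rule sum_mono)
    fix i
    show "c * (cmod ((conj_transpose U *v x) $ i))\<^sup>2 \<le> d i * (cmod ((conj_transpose U *v x) $ i))\<^sup>2"
      using xU[of i] by (cases "d i < c") (auto intro: mult_right_mono)
  qed
  also have "\<dots> \<le> x \<bullet> (spectral_form W e *v x)" using le by (simp add: loewner_le_def)
  also have "\<dots> < c * (x \<bullet> x)"
    unfolding n[OF W, symmetric] spectral_form_inner
  proof (rule sum_strict_mono_ex1)
    have le_c: "e i * (cmod ((conj_transpose W *v x) $ i))\<^sup>2 \<le> c * (cmod ((conj_transpose W *v x) $ i))\<^sup>2" for i
      using xW[of i] by (cases "e i < c") (auto intro: mult_right_mono)
    then show "\<forall>i\<in>UNIV. e i * (cmod ((conj_transpose W *v x) $ i))\<^sup>2 \<le> c * (cmod ((conj_transpose W *v x) $ i))\<^sup>2"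
      by blast
    have "conj_transpose W *v x \<noteq> 0" using x W by (simp add: unitary_conj_transpose_eq_0)
    then obtain i where i: "(conj_transpose W *v x) $ i \<noteq> 0" by (auto simp: vec_eq_iff)
    with xW[of i] have "e i < c" by (meson not_le)
    with i have "e i * (cmod ((conj_transpose W *v x) $ i))\<^sup>2 < c * (cmod ((conj_transpose W *v x) $ i))\<^sup>2"
      by (intro mult_strict_right_mono) auto
    then show "\<exists>i\<in>UNIV. e i * (cmod ((conj_transpose W *v x) $ i))\<^sup>2 < c * (cmod ((conj_transpose W *v x) $ i))\<^sup>2"
      by blast
  qed simp
  finally show False by simp
qed

text \<open>The eigenvalue lists are indexed compatibly instead of sorted, which makes this the
  entrywise order of the decreasingly ordered eigenvalues.\<close>

definition eigenvalues_le :: "complex^'n^'n \<Rightarrow> complex^'n^'n \<Rightarrow> bool" where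
  "eigenvalues_le X Y \<longleftrightarrow> (\<exists>U W d e. unitary_matrix U \<and> unitary_matrix W \<and>
     X = spectral_form U d \<and> Y = spectral_form W e \<and> (\<forall>i. 0 < d i \<and> d i \<le> e i))"

text \<open>Comparing eigenvalue counts at every threshold yields an injective matching of the two
  lists. On a finite index type it is a permutation, and permuting the columns of \<open>W\<close>
  accordingly aligns the indices.\<close>

theorem Weyl_monotonicity:
  fixes X Y :: "complex^'n^'n"
  assumes X: "positive_definite X" and Y: "positive_definite Y" and le: "loewner_le X Y"
  shows "eigenvalues_le X Y"
proof -
  obtain U d where U: "unitary_matrix U" and Xs: "X = spectral_form U d" and d: "\<And>i. 0 < d i"
    by (rule positive_definite_diagonalizable[OF X]) (rule that)
  obtain W e where W: "unitary_matrix W" and Ys: "Y = spectral_form W e"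
    by (rule positive_definite_diagonalizable[OF Y])
  have "card {i \<in> UNIV. c \<le> d i} \<le> card {j \<in> UNIV. c \<le> e j}" for c
    using spectral_count_mono[OF U W] le by (simp add: Xs Ys)
  from inj_on_card_ge_matching[OF finite finite this]
  obtain s :: "'n \<Rightarrow> 'n" where s: "inj s" "\<And>i. d i \<le> e (s i)" by auto
  then have bij: "bij s" by (simp add: bij_def finite_UNIV_inj_surj)
  define W' :: "complex^'n^'n" where "W' = (\<chi> i j. W $ i $ s j)"
  have "W' ** conj_transpose W' = W ** conj_transpose W"
    unfolding W'_def vec_eq_iff matrix_matrix_mult_def
    using sum.reindex_bij_betw[OF bij, of "\<lambda>k. W $ i $ k * cnj (W $ j $ k)" for i j] by simp
  then have W': "unitary_matrix W'"
    using W by (simp add: unitary_matrix_def matrix_left_right_inverse)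
  have "spectral_form W' (\<lambda>i. e (s i)) = spectral_form W e"
    unfolding vec_eq_iff spectral_form_nth W'_def
    using sum.reindex_bij_betw[OF bij, of "\<lambda>k. W $ i $ k * complex_of_real (e k) * cnj (W $ j $ k)" for i j]
    by simp
  then show ?thesis
    unfolding eigenvalues_le_def Xs Ys using U W' d s(2) by metis
qed

lemma eigenvalues_le_powr:
  assumes "eigenvalues_le X Y" "0 \<le> r"
  shows "eigenvalues_le (matrix_powr X r) (matrix_powr Y r)"
proof -
  obtain U W d e where U: "unitary_matrix U" and W: "unitary_matrix W"
    and X: "X = spectral_form U d" and Y: "Y = spectral_form W e" and d: "\<And>i. 0 < d i" "\<And>i. d i \<le> e i"
    using assms(1) by (auto simp: eigenvalues_le_def)
  have "0 < d i powr r" "d i powr r \<le> e i powr r" for i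
    using d[of i] assms(2) by (auto intro: powr_mono2)
  then show ?thesis
    unfolding eigenvalues_le_def X Y matrix_powr_spectral_form[OF U] matrix_powr_spectral_form[OF W]
    using U W by blast
qed

lemma eigenvalues_le_powr_neg:
  assumes "eigenvalues_le X Y" "r \<le> 0"
  shows "eigenvalues_le (matrix_powr Y r) (matrix_powr X r)"
proof -
  obtain U W d e where U: "unitary_matrix U" and W: "unitary_matrix W"
    and X: "X = spectral_form U d" and Y: "Y = spectral_form W e" and d: "\<And>i. 0 < d i" "\<And>i. d i \<le> e i"
    using assms(1) by (auto simp: eigenvalues_le_def)
  have "0 < e i powr r" "e i powr r \<le> d i powr r" for i
    using d[of i] assms(2) by (auto intro: powr_mono2')
  then show ?thesis
    unfolding eigenvalues_le_def X Y matrix_powr_spectral_form[OF U] matrix_powr_spectral_form[OF W]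
    using U W by blast
qed

section \<open>Unitarily invariant norms: monotonicity and continuity\<close>

lemma matrix_norm_scaleR:
  assumes "matrix_norm N" shows "N (c *\<^sub>R X) = \<bar>c\<bar> * N X"
proof -
  have "c *\<^sub>R X = map_matrix (\<lambda>z. complex_of_real c * z) X"
    by (simp add: vec_eq_iff map_matrix_def) (simp add: scaleR_conv_of_real)
  then show ?thesis using assms by (simp add: matrix_norm_def)
qed

text \<open>Lowering a single entry needs only one sign change \<open>S\<close>: the new matrix lies
  on the segment between the diagonal matrix and its image under the unitary \<open>S\<close>, whose
  endpoints have equal norm.\<close>

lemma matrix_norm_diag_upd_le:
  fixes N :: "complex^'n^'n \<Rightarrow> real"
  assumes N: "unitarily_invariant_norm N" and x: "0 \<le> x" "x \<le> e k"
  shows "N (diag_matrix (e(k := x))) \<le> N (diag_matrix e)"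
proof (cases "e k = 0")
  case True
  then have "e(k := x) = e" using x by auto
  then show ?thesis by simp
next
  case False
  then have ek: "0 < e k" using x by simp
  define S :: "complex^'n^'n" where "S = diag_matrix (\<lambda>i. if i = k then - 1 else 1)"
  \<comment> \<open>The solution of a e_k - (1 - a) e_k = x.\<close>
  define a where "a = (1 + x / e k) / 2"
  have a: "0 \<le> a" "a \<le> 1" using x ek by (auto simp: a_def field_simps)
  have "S ** S = mat 1"
    by (simp add: S_def diag_mult_diag) (simp add: vec_eq_iff diag_matrix_def mat_def)
  then have S: "unitary_matrix S" by (simp add: unitary_matrix_def S_def)
  have mn: "matrix_norm N" using N by (simp add: unitarily_invariant_norm_def)
  have N_flip: "N (S ** diag_matrix e) = N (diag_matrix e)"
  proof -
    have "unitary_matrix (mat 1 :: complex^'n^'n)" by (simp add: unitary_matrix_def)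
    then have "N (S ** diag_matrix e ** mat 1) = N (diag_matrix e)"
      using N S unfolding unitarily_invariant_norm_def by blast
    then show ?thesis by simp
  qed
  have "diag_matrix (e(k := x)) = a *\<^sub>R diag_matrix e + (1 - a) *\<^sub>R (S ** diag_matrix e)"
  proof -
    have "x = a * e k - (1 - a) * e k" using ek by (simp add: a_def field_simps)
    then have "complex_of_real x = of_real a * of_real (e k) - (1 - of_real a) * of_real (e k)"
      by (metis of_real_1 of_real_diff of_real_mult)
    then show ?thesis
      unfolding S_def diag_mult_diag
      by (simp add: vec_eq_iff diag_matrix_def) (simp add: scaleR_conv_of_real algebra_simps)
  qed
  then have "N (diag_matrix (e(k := x))) \<le> N (a *\<^sub>R diag_matrix e) + N ((1 - a) *\<^sub>R (S ** diag_matrix e))"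
    using mn by (simp add: matrix_norm_def)
  also have "\<dots> = N (diag_matrix e)"
    using a by (simp add: matrix_norm_scaleR[OF mn] N_flip) (simp add: algebra_simps)
  finally show ?thesis .
qed

lemma matrix_norm_diag_mono:
  fixes N :: "complex^'n^'n \<Rightarrow> real"
  assumes N: "unitarily_invariant_norm N" and d: "\<And>i. 0 \<le> d i" "\<And>i. d i \<le> e i"
  shows "N (diag_matrix d) \<le> N (diag_matrix e)"
proof -
  have "N (diag_matrix (\<lambda>i. if i \<in> I then d i else e i)) \<le> N (diag_matrix e)"
    if "finite I" for I
    using that
  proof (induction I rule: finite_induct)
    case (insert k I)
    let ?g = "\<lambda>i. if i \<in> I then d i else e i"
    have "(\<lambda>i. if i \<in> insert k I then d i else e i) = ?g(k := d k)" by auto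
    moreover have "N (diag_matrix (?g(k := d k))) \<le> N (diag_matrix ?g)"
      using d insert(2) by (intro matrix_norm_diag_upd_le[OF N]) auto
    ultimately show ?case using insert.IH by simp
  qed simp
  from this[of UNIV] show ?thesis by simp
qed

lemma eigenvalues_le_norm:
  assumes N: "unitarily_invariant_norm N" and "eigenvalues_le X Y"
  shows "N X \<le> N Y"
proof -
  obtain U W d e where U: "unitary_matrix U" and W: "unitary_matrix W"
    and X: "X = spectral_form U d" and Y: "Y = spectral_form W e" and d: "\<And>i. 0 < d i" "\<And>i. d i \<le> e i"
    using assms(2) by (auto simp: eigenvalues_le_def)
  have "N (spectral_form V g) = N (diag_matrix g)" if "unitary_matrix V" for V g
    using N that unitary_conj_transpose[OF that]
    unfolding spectral_form_def unitarily_invariant_norm_def by blast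
  moreover have "N (diag_matrix d) \<le> N (diag_matrix e)"
    by (intro matrix_norm_diag_mono[OF N] d less_imp_le)
  ultimately show ?thesis by (simp add: X Y U W)
qed

text \<open>Expansion in the matrix units \<open>E i j\<close>. The bound makes the abstract norm
  \<open>N\<close> Lipschitz for the Euclidean norm of the matrix type, in which limits are
  taken.\<close>

lemma matrix_norm_bound:
  fixes N :: "complex^'n^'n \<Rightarrow> real"
  assumes "matrix_norm N"
  obtains C where "\<And>X. N X \<le> C * norm X"
proof -
  define E :: "'n \<Rightarrow> 'n \<Rightarrow> complex^'n^'n" where "E i j = axis i (axis j 1)" for i j
  have tri: "N (\<Sum>a\<in>F. g a) \<le> (\<Sum>a\<in>F. N (g a))" if "finite F" for F :: "'n set" and g
    using that
  proof (induction F rule: finite_induct)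
    case empty
    have "N 0 = 0" using assms unfolding matrix_norm_def by blast
    then show ?case by simp
  next
    case (insert a F)
    have "N (g a + (\<Sum>a\<in>F. g a)) \<le> N (g a) + N (\<Sum>a\<in>F. g a)"
      using assms by (simp add: matrix_norm_def)
    then show ?case using insert by simp
  qed
  have "N X \<le> (\<Sum>i\<in>UNIV. \<Sum>j\<in>UNIV. N (E i j)) * norm X" for X
  proof -
    have "(\<Sum>j\<in>UNIV. X $ i $ j * E i j $ a $ b) = (if i = a then X $ a $ b else 0)" for i a b
      by (cases "i = a") (simp_all add: E_def axis_def if_distrib[where f = "\<lambda>x. _ * x"] cong: if_cong)
    then have "X = (\<Sum>i\<in>UNIV. \<Sum>j\<in>UNIV. map_matrix (\<lambda>z. X $ i $ j * z) (E i j))"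
      by (simp add: vec_eq_iff map_matrix_def)
    then have "N X = N (\<Sum>i\<in>UNIV. \<Sum>j\<in>UNIV. map_matrix (\<lambda>z. X $ i $ j * z) (E i j))"
      by (rule arg_cong)
    also have "\<dots> \<le> (\<Sum>i\<in>UNIV. N (\<Sum>j\<in>UNIV. map_matrix (\<lambda>z. X $ i $ j * z) (E i j)))"
      by (rule tri) simp
    also have "\<dots> \<le> (\<Sum>i\<in>UNIV. \<Sum>j\<in>UNIV. N (map_matrix (\<lambda>z. X $ i $ j * z) (E i j)))"
      by (intro sum_mono tri) simp
    also have "\<dots> = (\<Sum>i\<in>UNIV. \<Sum>j\<in>UNIV. cmod (X $ i $ j) * N (E i j))"
      using assms by (simp add: matrix_norm_def)
    also have "\<dots> \<le> (\<Sum>i\<in>UNIV. \<Sum>j\<in>UNIV. norm X * N (E i j))"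
    proof (intro sum_mono mult_right_mono)
      fix i j
      show "cmod (X $ i $ j) \<le> norm X"
        using Finite_Cartesian_Product.norm_nth_le[of "X $ i" j] Finite_Cartesian_Product.norm_nth_le[of X i] by linarith
      show "0 \<le> N (E i j)" using assms by (simp add: matrix_norm_def)
    qed
    finally show ?thesis by (simp add: sum_distrib_left mult.commute)
  qed
  then show ?thesis by (rule that)
qed

lemma tendsto_matrix_norm:
  assumes N: "matrix_norm N" and f: "(f \<longlongrightarrow> X) F"
  shows "((\<lambda>p. N (f p)) \<longlongrightarrow> N X) F"
proof -
  obtain C where C: "\<And>X. N X \<le> C * norm X" by (rule matrix_norm_bound[OF N]) (rule that)
  have tri: "N Y \<le> N Z + C * norm (Y - Z)" for Y Z
  proof -
    have "N (Z + (Y - Z)) \<le> N Z + N (Y - Z)" using N unfolding matrix_norm_def by blast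
    then show ?thesis using C[of "Y - Z"] by simp
  qed
  have "norm (N (f p) - N X) \<le> C * norm (f p - X)" for p
    using tri[of "f p" X] tri[of X "f p"] by (simp add: norm_minus_commute abs_le_iff)
  then have "\<forall>\<^sub>F p in F. norm (N (f p) - N X) \<le> C * norm (f p - X)"
    by (intro always_eventually allI)
  moreover have "((\<lambda>p. C * norm (f p - X)) \<longlongrightarrow> 0) F"
    using tendsto_mult_right_zero[OF tendsto_norm_zero[OF LIM_zero[OF f]], of C] .
  ultimately have "((\<lambda>p. N (f p) - N X) \<longlongrightarrow> 0) F"
    by (rule Lim_null_comparison)
  then show ?thesis by (rule LIM_zero_cancel)
qed

section \<open>The limit at zero\<close>

text \<open>The diagonal entry of U* X U. As a continuous expression in \<open>U\<close> and the
  matrix, it forces the eigenvalues to converge along with these.\<close>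

lemma spectral_form_eigenvalue:
  assumes "unitary_matrix U"
  shows "d i = Re (\<Sum>j\<in>UNIV. \<Sum>k\<in>UNIV. cnj (U $ j $ i) * spectral_form U d $ j $ k * U $ k $ i)"
proof -
  have "conj_transpose U ** spectral_form U d ** U
      = (conj_transpose U ** U) ** diag_matrix d ** (conj_transpose U ** U)"
    by (simp add: spectral_form_def matrix_mul_assoc)
  also have "\<dots> = diag_matrix d" using assms by (simp add: unitary_matrix_def)
  finally have "(conj_transpose U ** spectral_form U d ** U) $ i $ i = diag_matrix d $ i $ i" by simp
  then have "of_real (d i) = (\<Sum>k\<in>UNIV. \<Sum>j\<in>UNIV. cnj (U $ j $ i) * spectral_form U d $ j $ k * U $ k $ i)"
    by (simp add: matrix_matrix_mult_def sum_distrib_right diag_matrix_def)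
  then show ?thesis
    by (subst sum.swap) (metis Re_complex_of_real)
qed

text \<open>The columns are unit vectors, so every entry has modulus at most 1; closedness holds
  because the defining equations are continuous in the entries.\<close>

lemma compact_unitary_matrices: "compact {U :: complex^'n^'n. unitary_matrix U}"
proof -
  have "norm U \<le> real CARD('n) * real CARD('n)" if "unitary_matrix U" for U :: "complex^'n^'n"
  proof -
    have c: "cmod (U $ i $ j) \<le> 1" for i j
    proof -
      have "norm (U *v axis j 1) = norm (axis j 1 :: complex^'n)" by (rule unitary_norm[OF that])
      then have "norm (U *v axis j 1) = 1" by simp
      moreover have "(U *v axis j 1) $ i = U $ i $ j"
        by (simp add: matrix_vector_mult_def axis_def if_distrib[where f = "\<lambda>x. _ * x"] cong: if_cong)
      ultimately show ?thesis by (metis Finite_Cartesian_Product.norm_nth_le)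
    qed
    have "norm (U $ i) \<le> (\<Sum>j\<in>(UNIV :: 'n set). 1)" for i
    proof -
      have "norm (U $ i) \<le> (\<Sum>j\<in>UNIV. norm (U $ i $ j))"
        by (simp add: norm_vec_def L2_set_le_sum)
      also have "\<dots> \<le> (\<Sum>j\<in>(UNIV :: 'n set). 1)" by (rule sum_mono) (rule c)
      finally show ?thesis .
    qed
    then have "norm (U $ i) \<le> real CARD('n)" for i by simp
    then have "(\<Sum>i\<in>UNIV. norm (U $ i)) \<le> real CARD('n) * real CARD('n)"
      using sum_mono[of UNIV "\<lambda>i. norm (U $ i)" "\<lambda>i. real CARD('n)"] by simp
    moreover have "norm U \<le> (\<Sum>i\<in>UNIV. norm (U $ i))"
      by (simp add: norm_vec_def L2_set_le_sum)
    ultimately show ?thesis by linarith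
  qed
  then have "bounded {U :: complex^'n^'n. unitary_matrix U}" by (auto simp: bounded_iff)
  moreover have "closed {U :: complex^'n^'n. unitary_matrix U}"
    unfolding unitary_matrix_def vec_eq_iff matrix_matrix_mult_def
    by (simp, intro closed_Collect_conj closed_Collect_all closed_Collect_eq continuous_intros)
  ultimately show ?thesis by (simp add: compact_eq_bounded_closed)
qed

lemma tendsto_matrixI:
  fixes f :: "'b \<Rightarrow> complex^'n^'m"
  assumes "\<And>i j. ((\<lambda>p. f p $ i $ j) \<longlongrightarrow> X $ i $ j) F"
  shows "(f \<longlongrightarrow> X) F"
  by (intro vec_tendstoI assms)

text \<open>Continuity of the functional calculus, allowing the function to vary. Any subsequence has a
  further subsequence along which the diagonalising unitaries converge, hence so do the eigenvalues.\<close>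

lemma functional_calculus_sequentially:
  fixes X :: "nat \<Rightarrow> complex^'n^'n"
  assumes X: "\<And>n. hermitian_matrix (X n)" and lim: "X \<longlonglongrightarrow> L"
    and f: "\<And>s x y. strict_mono s \<Longrightarrow> x \<longlonglongrightarrow> y \<Longrightarrow> (\<lambda>n. f (s n) (x n)) \<longlonglongrightarrow> g y"
  shows "(\<lambda>n. functional_calculus (f n) (X n)) \<longlonglongrightarrow> functional_calculus g L"
proof (rule ccontr)
  let ?F = "\<lambda>n. functional_calculus (f n) (X n)"
  assume "\<not> ?F \<longlonglongrightarrow> functional_calculus g L"
  then have "\<exists>e>0. \<forall>m. \<exists>n\<ge>m. e \<le> dist (?F n) (functional_calculus g L)"
    unfolding lim_sequentially by (simp add: not_less)
  then obtain e where e: "e > 0" "\<forall>m. \<exists>n\<ge>m. e \<le> dist (?F n) (functional_calculus g L)"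
    by blast
  have "\<exists>s :: nat \<Rightarrow> nat. strict_mono s \<and> (\<forall>n. e \<le> dist (?F (s n)) (functional_calculus g L))"
  proof -
    have "infinite {n. e \<le> dist (?F n) (functional_calculus g L)}"
      using e(2) unfolding infinite_nat_iff_unbounded_le by simp
    from infinite_enumerate[OF this] show ?thesis by simp
  qed
  then obtain s :: "nat \<Rightarrow> nat" where s: "strict_mono s"
    and far: "\<And>n. e \<le> dist (?F (s n)) (functional_calculus g L)" by blast
  have "\<forall>n. \<exists>U d. unitary_matrix U \<and> X (s n) = spectral_form U d"
    using hermitian_diagonalizable[OF X] by metis
  then obtain U d where U: "\<And>n. unitary_matrix (U n)" and Xs: "\<And>n. X (s n) = spectral_form (U n) (d n)"
    by metis
  obtain V r where V: "unitary_matrix V" and r: "strict_mono r" and UV: "(U \<circ> r) \<longlonglongrightarrow> V"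
    using compact_unitary_matrices[unfolded compact_def, rule_format, of U] U by auto
  have UVij: "(\<lambda>n. U (r n) $ i $ j) \<longlonglongrightarrow> V $ i $ j" for i j
    using tendsto_vec_nth[OF tendsto_vec_nth[OF UV]] by (simp add: comp_def)
  have sr: "strict_mono (s \<circ> r)" using s r by (rule strict_mono_o)
  have "(X \<circ> (s \<circ> r)) \<longlonglongrightarrow> L" using lim sr by (rule LIMSEQ_subseq_LIMSEQ)
  then have XL: "(\<lambda>n. spectral_form (U (r n)) (d (r n)) $ i $ j) \<longlonglongrightarrow> L $ i $ j" for i j
    using tendsto_vec_nth[OF tendsto_vec_nth] by (simp add: comp_def Xs)
  define D where "D i = Re (\<Sum>j\<in>UNIV. \<Sum>k\<in>UNIV. cnj (V $ j $ i) * L $ j $ k * V $ k $ i)" for i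
  have D: "(\<lambda>n. d (r n) i) \<longlonglongrightarrow> D i" for i
  proof -
    have d_eq: "d (r n) i = Re (\<Sum>j\<in>UNIV. \<Sum>k\<in>UNIV.
        cnj (U (r n) $ j $ i) * spectral_form (U (r n)) (d (r n)) $ j $ k * U (r n) $ k $ i)" for n
      by (rule spectral_form_eigenvalue[OF U])
    show ?thesis unfolding D_def d_eq by (intro tendsto_intros UVij XL)
  qed
  have "(\<lambda>n. spectral_form (U (r n)) (d (r n))) \<longlonglongrightarrow> spectral_form V D"
    by (rule tendsto_matrixI, unfold spectral_form_nth) (intro tendsto_intros UVij D)
  moreover have "(\<lambda>n. spectral_form (U (r n)) (d (r n))) \<longlonglongrightarrow> L"
    by (rule tendsto_matrixI) (rule XL)
  \<comment> \<open>The limit inherits a diagonalisation, so the functional calculus at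
    \<open>L\<close> can be evaluated through \<open>V\<close> and \<open>D\<close>.\<close>
  ultimately have L: "L = spectral_form V D" using LIMSEQ_unique by blast
  \<comment> \<open>The convergence hypothesis on \<open>f\<close> covers arbitrary subsequences of
    indices because it is invoked here along \<open>s \<circ> r\<close>.\<close>
  have "(\<lambda>n. spectral_form (U (r n)) (\<lambda>i. f (s (r n)) (d (r n) i))) \<longlonglongrightarrow> spectral_form V (\<lambda>i. g (D i))"
    using f[OF sr D] by (intro tendsto_matrixI, unfold spectral_form_nth comp_def) (intro tendsto_intros UVij)
  then have "(\<lambda>n. ?F (s (r n))) \<longlonglongrightarrow> functional_calculus g L"
    by (simp add: Xs L functional_calculus_spectral_form U V)
  then obtain n where "dist (?F (s (r n))) (functional_calculus g L) < e"
    using eventually_happens'[OF sequentially_bot tendstoD[OF _ e(1)]] by blast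
  with far[of "r n"] show False by simp
qed

text \<open>Near the limit the power is exp (ln (1 + p x) / p), and |ln (1 + u) - u| \<le> 2 u^2 for
  |u| < 1/2 controls the exponent for either sign of p. The argument \<open>x\<close> varies with n
  since it stands for an eigenvalue of a converging matrix.\<close>

lemma tendsto_powr_inverse_exp:
  fixes p x :: "nat \<Rightarrow> real"
  assumes p: "p \<longlonglongrightarrow> 0" "\<And>n. p n \<noteq> 0" and x: "x \<longlonglongrightarrow> y"
  shows "(\<lambda>n. (1 + p n * x n) powr (1 / p n)) \<longlonglongrightarrow> exp y"
proof -
  have px: "(\<lambda>n. p n * x n) \<longlonglongrightarrow> 0" using tendsto_mult[OF p(1) x] by simp
  then have ev: "\<forall>\<^sub>F n in sequentially. \<bar>p n * x n\<bar> < 1 / 2"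
    using order_tendstoD(2)[OF tendsto_rabs_zero[OF px], of "1/2"] by simp
  have "(\<lambda>n. ln (1 + p n * x n) / p n - x n) \<longlonglongrightarrow> 0"
  proof (rule Lim_null_comparison)
    show "\<forall>\<^sub>F n in sequentially. norm (ln (1 + p n * x n) / p n - x n) \<le> 2 * \<bar>p n * x n\<bar> * \<bar>x n\<bar>"
      using ev
    proof eventually_elim
      case (elim n)
      have "ln (1 + p n * x n) / p n - x n = (ln (1 + p n * x n) - p n * x n) / p n"
        using p(2)[of n] by (simp add: field_simps)
      also have "norm \<dots> = \<bar>ln (1 + p n * x n) - p n * x n\<bar> / \<bar>p n\<bar>" by simp
      also have "\<dots> \<le> 2 * (p n * x n)\<^sup>2 / \<bar>p n\<bar>"
        using abs_ln_one_plus_x_minus_x_bound[of "p n * x n"] elim by (intro divide_right_mono) auto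
      also have "\<dots> = 2 * \<bar>p n * x n\<bar> * \<bar>x n\<bar>"
      proof -
        have "(p n * x n)\<^sup>2 = \<bar>p n * x n\<bar> * (\<bar>p n\<bar> * \<bar>x n\<bar>)"
          by (metis abs_mult abs_mult_self_eq power2_eq_square)
        then show ?thesis using p(2)[of n] by simp
      qed
      finally show ?case .
    qed
    show "(\<lambda>n. 2 * \<bar>p n * x n\<bar> * \<bar>x n\<bar>) \<longlonglongrightarrow> 0"
      using tendsto_mult[OF tendsto_mult[OF tendsto_const[of 2] tendsto_rabs[OF px]] tendsto_rabs[OF x]] by simp
  qed
  from tendsto_add[OF this x] have "(\<lambda>n. ln (1 + p n * x n) / p n) \<longlonglongrightarrow> y" by simp
  then have "(\<lambda>n. exp (ln (1 + p n * x n) / p n)) \<longlonglongrightarrow> exp y" by (rule tendsto_exp)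
  then show ?thesis
  proof (rule Lim_transform_eventually)
    show "\<forall>\<^sub>F n in sequentially. exp (ln (1 + p n * x n) / p n) = (1 + p n * x n) powr (1 / p n)"
      using ev by eventually_elim (auto simp: powr_def)
  qed
qed

text \<open>The derivative of d^p at p = 0, taken eigenvalue by eigenvalue in one fixed
  diagonalisation of \<open>A\<close>.\<close>

lemma tendsto_matrix_powr_log:
  fixes A :: "complex^'n^'n"
  assumes A: "positive_definite A"
  shows "((\<lambda>p. (1 / p) *\<^sub>R (matrix_powr A p - mat 1)) \<longlongrightarrow> matrix_log A) (at 0)"
proof (rule positive_definite_diagonalizable[OF A])
  fix U d assume U: "unitary_matrix U" and As: "A = spectral_form U d" and d: "\<And>i. 0 < d i"
  have lim: "((\<lambda>p. 1 / p * (d i powr p - 1)) \<longlongrightarrow> ln (d i)) (at 0)" for i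
  proof -
    have "((\<lambda>p. d i powr p) has_real_derivative ln (d i)) (at 0)"
      using d[of i] by (auto intro!: derivative_eq_intros)
    then show ?thesis using d[of i] by (simp add: has_field_derivative_iff)
  qed
  have "(1 / p) *\<^sub>R (matrix_powr A p - mat 1) = spectral_form U (\<lambda>i. 1 / p * (d i powr p - 1))" for p
    by (simp only: As matrix_powr_spectral_form[OF U] spectral_form_affine[OF U])
  moreover have "matrix_log A = spectral_form U (\<lambda>i. ln (d i))"
    by (simp add: As matrix_log_def functional_calculus_spectral_form U)
  ultimately show ?thesis
    by (simp only:) (intro tendsto_matrixI, unfold spectral_form_nth, intro tendsto_intros lim)
qed

lemma power_mean_nonzero:
  "p \<noteq> 0 \<Longrightarrow> power_mean A B t p = matrix_powr (wavg t (matrix_powr A p) (matrix_powr B p)) (1 / p)"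
  by (simp add: power_mean_def wavg_def)

text \<open>With M the average of the p-th powers, the mean is the function x -> (1 + p x)^(1/p)
  applied to X = (M - 1)/p. Here X tends to the average of the logarithms while the functions tend
  to exp, so both the matrix and the function vary.\<close>

theorem power_mean_tendsto_0:
  fixes A B :: "complex^'n^'n"
  assumes A: "positive_definite A" and B: "positive_definite B" and t: "0 \<le> t" "t \<le> 1"
  shows "(power_mean A B t \<longlongrightarrow> matrix_exp ((1 - t) *\<^sub>R matrix_log A + t *\<^sub>R matrix_log B)) (at 0)"
proof -
  let ?L = "(1 - t) *\<^sub>R matrix_log A + t *\<^sub>R matrix_log B"
  define X where "X p = (1 / p) *\<^sub>R (wavg t (matrix_powr A p) (matrix_powr B p) - mat 1)" for p
  have X_eq: "X p = (1 - t) *\<^sub>R ((1 / p) *\<^sub>R (matrix_powr A p - mat 1)) + t *\<^sub>R ((1 / p) *\<^sub>R (matrix_powr B p - mat 1))" for p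
    unfolding X_def wavg_def vec_eq_iff
    by (simp, simp add: scaleR_conv_of_real algebra_simps add_divide_distrib diff_divide_distrib)
  have X: "(X \<longlongrightarrow> ?L) (at 0)"
    unfolding X_eq by (intro tendsto_intros tendsto_matrix_powr_log A B)
  have pd: "positive_definite (wavg t (matrix_powr A p) (matrix_powr B p))" for p
    by (intro positive_definite_wavg positive_definite_powr A B t)
  have pm: "hermitian_matrix (X p) \<and> functional_calculus (\<lambda>x. (1 + p * x) powr (1 / p)) (X p) = power_mean A B t p"
    if "p \<noteq> 0" for p
  proof (rule positive_definite_diagonalizable[OF pd[of p]])
    fix U d assume U: "unitary_matrix U" and M: "wavg t (matrix_powr A p) (matrix_powr B p) = spectral_form U d"
    have "X p = spectral_form U (\<lambda>i. 1 / p * (d i - 1))"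
      by (simp only: X_def M spectral_form_affine[OF U])
    then show ?thesis
      using that by (simp add: power_mean_nonzero M U functional_calculus_spectral_form
          hermitian_spectral_form matrix_powr_spectral_form)
  qed
  show ?thesis
    unfolding tendsto_at_iff_sequentially
  proof (intro allI impI)
    fix p :: "nat \<Rightarrow> real"
    assume "\<forall>i. p i \<in> UNIV - {0}" and p0: "p \<longlonglongrightarrow> 0"
    then have p: "p n \<noteq> 0" for n by auto
    have "(\<lambda>n. X (p n)) \<longlonglongrightarrow> ?L"
      using X p p0 by (auto simp: tendsto_at_iff_sequentially comp_def)
    moreover have "(\<lambda>n. (1 + p (s n) * x n) powr (1 / p (s n))) \<longlonglongrightarrow> exp y"
      if "strict_mono s" "x \<longlonglongrightarrow> y" for s x y
      using LIMSEQ_subseq_LIMSEQ[OF p0 that(1)] p that(2)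
      by (intro tendsto_powr_inverse_exp) (auto simp: comp_def)
    ultimately have "(\<lambda>n. functional_calculus (\<lambda>x. (1 + p n * x) powr (1 / p n)) (X (p n)))
        \<longlonglongrightarrow> functional_calculus exp ?L"
      using pm[OF p] by (intro functional_calculus_sequentially) auto
    then show "(power_mean A B t \<circ> p) \<longlonglongrightarrow> matrix_exp ?L"
      using pm[OF p] by (simp add: comp_def matrix_exp_def)
  qed
qed

section \<open>Monotonicity of power means\<close>

lemma power_mean_pos_mono:
  assumes A: "positive_definite A" and B: "positive_definite B" and t: "0 \<le> t" "t \<le> 1"
    and "0 < p" "p \<le> q"
  shows "eigenvalues_le (power_mean A B t p) (power_mean A B t q)"
proof -
  let ?X = "matrix_powr A q" and ?Y = "matrix_powr B q"
  have X: "positive_definite ?X" "positive_definite ?Y" by (intro positive_definite_powr A B)+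
  have r: "0 \<le> p / q" "p / q \<le> 1" "q \<noteq> 0" "p \<noteq> 0" using assms(5,6) by auto
  have "eigenvalues_le (wavg t (matrix_powr ?X (p / q)) (matrix_powr ?Y (p / q))) (matrix_powr (wavg t ?X ?Y) (p / q))"
    by (intro Weyl_monotonicity operator_concave_powr positive_definite_wavg positive_definite_powr X t r)
  \<comment> \<open>On the right the exponents multiply to (p/q)(1/p) = 1/q, which restores the mean
    of order \<open>q\<close>.\<close>
  from eigenvalues_le_powr[OF this, of "1 / p"] show ?thesis
    using assms(5) r by (simp add: power_mean_nonzero matrix_powr_powr A B positive_definite_wavg X t)
qed

lemma power_mean_neg_mono:
  assumes A: "positive_definite A" and B: "positive_definite B" and t: "0 \<le> t" "t \<le> 1"
    and "p \<le> q" "q < 0"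
  shows "eigenvalues_le (power_mean A B t p) (power_mean A B t q)"
proof -
  let ?X = "matrix_powr A p" and ?Y = "matrix_powr B p"
  have X: "positive_definite ?X" "positive_definite ?Y" by (intro positive_definite_powr A B)+
  have r: "0 \<le> q / p" "q / p \<le> 1" "q \<noteq> 0" "p \<noteq> 0"
    using assms(5,6) by (auto simp: divide_le_eq zero_le_divide_iff)
  have "eigenvalues_le (wavg t (matrix_powr ?X (q / p)) (matrix_powr ?Y (q / p))) (matrix_powr (wavg t ?X ?Y) (q / p))"
    by (intro Weyl_monotonicity operator_concave_powr positive_definite_wavg positive_definite_powr X t r)
  from eigenvalues_le_powr_neg[OF this, of "1 / q"] show ?thesis
    using assms(6) r by (simp add: power_mean_nonzero matrix_powr_powr A B positive_definite_wavg X t)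
qed

text \<open>For q > 0 all values at p in (0,q) are at most \<open>h q\<close>, hence so is their
  limit \<open>h 0\<close>; the left side is symmetric, and \<open>h 0\<close> links the two
  half-lines.\<close>

lemma mono_of_mono_off_zero:
  fixes h :: "real \<Rightarrow> real"
  assumes lim: "(h \<longlongrightarrow> h 0) (at 0)"
    and pos: "\<And>p q. 0 < p \<Longrightarrow> p \<le> q \<Longrightarrow> h p \<le> h q"
    and neg: "\<And>p q. p \<le> q \<Longrightarrow> q < 0 \<Longrightarrow> h p \<le> h q"
  shows "mono h"
proof -
  have z: "h 0 \<le> h q" if "0 < q" for q
  proof (rule tendsto_upperbound)
    show "(h \<longlongrightarrow> h 0) (at_right 0)" using lim by (rule filterlim_mono) (auto simp: at_le)
    show "\<forall>\<^sub>F p in at_right 0. h p \<le> h q"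
      unfolding eventually_at_right[OF that] using pos that by (intro exI[of _ q]) auto
  qed simp
  have n: "h p \<le> h 0" if "p < 0" for p
  proof (rule tendsto_lowerbound)
    show "(h \<longlongrightarrow> h 0) (at_left 0)" using lim by (rule filterlim_mono) (auto simp: at_le)
    show "\<forall>\<^sub>F q in at_left 0. h p \<le> h q"
      unfolding eventually_at_left[OF that] using neg that by (intro exI[of _ p]) auto
  qed simp
  show ?thesis
  proof (rule monoI)
    fix p q :: real assume "p \<le> q"
    then consider "0 < p" | "q < 0" | "p = 0" "q = 0" | "p = 0" "0 < q" | "p < 0" "q = 0" | "p < 0" "0 < q"
      by linarith
    then show "h p \<le> h q"
      by cases (use \<open>p \<le> q\<close> pos neg z n order_trans[OF n z] in auto)
  qed
qed

text \<open>The first conjunct confirms that the value assigned to \<open>power_mean\<close> at 0 is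
  the limit of the means; the second relies on it for continuity of the norm there.\<close>

theorem mainTheorem2:
  fixes A B :: "complex^'n^'n" and t :: real
  assumes "positive_definite A" and "positive_definite B"
    and "0 \<le> t" and "t \<le> 1"
  shows "(power_mean A B t \<longlongrightarrow>
            matrix_exp ((1 - t) *\<^sub>R matrix_log A + t *\<^sub>R matrix_log B)) (at 0) \<and>
         (\<forall>N. unitarily_invariant_norm N \<longrightarrow> mono (\<lambda>p. N (power_mean A B t p)))"
proof (intro conjI allI impI)
  show lim: "(power_mean A B t \<longlongrightarrow>
            matrix_exp ((1 - t) *\<^sub>R matrix_log A + t *\<^sub>R matrix_log B)) (at 0)"
    by (rule power_mean_tendsto_0[OF assms])
  fix N :: "complex^'n^'n \<Rightarrow> real"
  assume N: "unitarily_invariant_norm N"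
  show "mono (\<lambda>p. N (power_mean A B t p))"
  proof (rule mono_of_mono_off_zero)
    have "matrix_norm N" using N by (simp add: unitarily_invariant_norm_def)
    then show "((\<lambda>p. N (power_mean A B t p)) \<longlongrightarrow> N (power_mean A B t 0)) (at 0)"
      using tendsto_matrix_norm[OF _ lim] by (simp add: power_mean_def)
  qed (auto intro: eigenvalues_le_norm[OF N] power_mean_pos_mono[OF assms] power_mean_neg_mono[OF assms])
qed

end
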